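(* Let $$f(\zeta,u)=g_1\log\zeta+g_2\zeta,$$ where $g_1=g_1(u)\ne0$ and $g_2=g_2(u)$ are complex-valued functions, and suppose that the corresponding vacuum pp-wave is of type $(0,2)$, i.e. $d\alpha\wedge d\alpha^*\neq0$ (so that it belongs to the logarithmic $\mathrm L_{23}$ class). Then the following are equivalent: (i) $d\alpha\wedge d\alpha^*\wedge d\nu=0$; (ii) $Y=0$; (iii) $g_2=0$.
   Context: Setting. Everything is local, on a small connected coordinate domain (with $\zeta\neq0$) with coordinates $(\zeta,\zeta^*,u,v)$, $\zeta$ complex, $u,v$ real; $^*$ (or a bar) is complex conjugation. A (non-flat) vacuum pp-wave is a metric $ds^2=2\,d\zeta\,d\bar\zeta-2\,du\,dv-2(f+\bar f)\,du^2$ with $f=f(\zeta,u)$ complex analytic in $\zeta$, smooth in $u$, $f_{\zeta\zeta}\neq0$ everywhere. Inequalities "$\ne$" are meant at every point, equalities identically. Normalized tetrad and scalars. Let $a=\tfrac14\log f_{\zeta\zeta}$ and $\alpha=e^{a-a^*}(a_\zeta)^*$ (which is nowhere zero here). Write $\zeta=Z(a,u)$, $L=\log Z_a$ (functions of $(a,u)$), and let $\omega^1=(\alpha^* )^{-1}da=e^{a-a^*}(d\zeta-Z_u\,du)$, $\omega^2=(\omega^1)^*$, $\omega^3=e^{a+a^*}du$, $\omega^4=e^{-a-a^*}\big((f+f^*+Z_uZ_u^* )du+dv-Z_u\,d\zeta^*-Z_u^*\,d\zeta\big)$, so the metric is $2\omega^1\omega^2-2\omega^3\omega^4$. Its dual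 frame $(\delta,\delta^*,\Delta,D)$ is the null tetrad normalized by $\Psi_4=1$, $\gamma=0$ (Newman–Penrose notation). On functions of $(a,a^*,u)$: $\delta Q=\alpha^*Q_a$, $\delta^*Q=\alpha Q_{a^*}$, $\Delta Q=e^{-a-a^*}Q_u$ ($a,a^*$ fixed), $DQ=0$. The remaining spin coefficients are $\mu=e^{-a-a^*}L_u$ and $\nu=e^{-a-3a^*}(Z_{uu}+(f_\zeta)^* )$. Invariants: $A=\delta^*\alpha/\alpha^2$ and $Y=(3-A)\nu-1/\alpha+(\Delta\mu+\mu^2)/\alpha^*$. *)

theory Defs
  imports "HOL-Complex_Analysis.Complex_Analysis"
begin

text \<open>Points of the coordinate domain, and tangent vectors, are triples
  \<open>(\<zeta>, u, v)\<close> with \<open>\<zeta>\<close> complex and \<open>u\<close>, \<open>v\<close> real.  Complex one-forms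
  are real-linear maps from tangent vectors to the complex numbers.  Functions of \<open>\<zeta>\<close>
  and \<open>u\<close> only (such as \<open>f\<close> and \<open>a\<close>) are curried.\<close>

type_synonym event = "complex \<times> real \<times> real"
type_synonym scalar = "event \<Rightarrow> complex"
type_synonym form = "event \<Rightarrow> complex"

definition zeta_of :: "event \<Rightarrow> complex" where "zeta_of p = fst p"
definition u_of :: "event \<Rightarrow> real" where "u_of p = fst (snd p)"
definition v_of :: "event \<Rightarrow> real" where "v_of p = snd (snd p)"

definition base :: "event set \<Rightarrow> (complex \<times> real) set" where
  "base M = (\<lambda>p. (zeta_of p, u_of p)) ` M"


section \<open>Differentials and exterior products\<close>

definition differential :: "scalar \<Rightarrow> event \<Rightarrow> form" where
  "differential Q p = frechet_derivative Q (at p)"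

definition wedge2 :: "form \<Rightarrow> form \<Rightarrow> event \<Rightarrow> event \<Rightarrow> complex" where
  "wedge2 \<omega> \<eta> X Y = \<omega> X * \<eta> Y - \<omega> Y * \<eta> X"

definition wedge3 :: "form \<Rightarrow> form \<Rightarrow> form \<Rightarrow> event \<Rightarrow> event \<Rightarrow> event \<Rightarrow> complex" where
  "wedge3 \<omega> \<eta> \<theta> X Y W =
     \<omega> X * wedge2 \<eta> \<theta> Y W - \<omega> Y * wedge2 \<eta> \<theta> X W + \<omega> W * wedge2 \<eta> \<theta> X Y"

text \<open>Wirtinger and ordinary partial derivatives in the coordinates
  \<open>(\<zeta>, \<zeta>\<^sup>*, u, v)\<close>.\<close>

definition d_zeta :: "scalar \<Rightarrow> scalar" where
  "d_zeta Q p = (differential Q p (1, 0, 0) - \<i> * differential Q p (\<i>, 0, 0)) / 2"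

definition d_zetabar :: "scalar \<Rightarrow> scalar" where
  "d_zetabar Q p = (differential Q p (1, 0, 0) + \<i> * differential Q p (\<i>, 0, 0)) / 2"

definition d_u :: "scalar \<Rightarrow> scalar" where
  "d_u Q p = differential Q p (0, 1, 0)"

definition d_v :: "scalar \<Rightarrow> scalar" where
  "d_v Q p = differential Q p (0, 0, 1)"


section \<open>Vacuum pp-waves\<close>

text \<open>\<open>f\<close> is holomorphic in \<open>\<zeta>\<close> and smooth in \<open>u\<close>: here \<open>F n\<close> is the \<open>n\<close>-th derivative of
  \<open>f\<close> with respect to \<open>u\<close>.  Since every \<open>F n\<close> is continuous and holomorphic in \<open>\<zeta>\<close>,
  all mixed derivatives exist and are continuous as well.\<close>

definition analytic_smooth :: "(complex \<times> real) set \<Rightarrow> (complex \<Rightarrow> real \<Rightarrow> complex) \<Rightarrow> bool" where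
  "analytic_smooth B f \<longleftrightarrow>
     (\<exists>F :: nat \<Rightarrow> complex \<Rightarrow> real \<Rightarrow> complex.
        (\<forall>(z, u)\<in>B. F 0 z u = f z u) \<and>
        (\<forall>n. continuous_on B (\<lambda>(z, u). F n z u)) \<and>
        (\<forall>n. \<forall>(z, u)\<in>B. (\<lambda>w. F n w u) field_differentiable at z) \<and>
        (\<forall>n. \<forall>(z, u)\<in>B. ((\<lambda>t. F n z t) has_vector_derivative F (Suc n) z u) (at u)))"

definition f_zeta :: "(complex \<Rightarrow> real \<Rightarrow> complex) \<Rightarrow> complex \<Rightarrow> real \<Rightarrow> complex" where
  "f_zeta f z u = deriv (\<lambda>w. f w u) z"

definition f_zeta_zeta :: "(complex \<Rightarrow> real \<Rightarrow> complex) \<Rightarrow> complex \<Rightarrow> real \<Rightarrow> complex" where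
  "f_zeta_zeta f z u = deriv (\<lambda>w. f_zeta f w u) z"

definition vacuum_pp_wave :: "event set \<Rightarrow> (complex \<Rightarrow> real \<Rightarrow> complex) \<Rightarrow> bool" where
  "vacuum_pp_wave M f \<longleftrightarrow>
     open M \<and> connected M \<and> (\<forall>p\<in>M. zeta_of p \<noteq> 0) \<and>
     analytic_smooth (base M) f \<and> (\<forall>(z, u)\<in>base M. f_zeta_zeta f z u \<noteq> 0)"

text \<open>The quadratic form of the metric; it is real, but it is written with complex values
  for comparison with the null coframe below.\<close>

definition pp_metric :: "(complex \<Rightarrow> real \<Rightarrow> complex) \<Rightarrow> event \<Rightarrow> event \<Rightarrow> complex" where
  "pp_metric f p X =
     2 * zeta_of X * cnj (zeta_of X) - 2 * of_real (u_of X) * of_real (v_of X)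
     - 2 * (f (zeta_of p) (u_of p) + cnj (f (zeta_of p) (u_of p))) * (of_real (u_of X))\<^sup>2"


section \<open>The coordinate \<open>a\<close> and its inverse\<close>

text \<open>A choice of the branch of \<open>a = (1/4) log f\<^sub>\<zeta>\<^sub>\<zeta>\<close> on the domain.  As the
  considerations are local, the domain is so small that such a branch exists and that
  \<open>(a, u)\<close> can replace \<open>(\<zeta>, u)\<close> as coordinates.  Holomorphy and injectivity imply that
  the derivative of \<open>a\<close> with respect to \<open>\<zeta>\<close> has no zero.\<close>

definition normalizing_coordinate ::
  "event set \<Rightarrow> (complex \<Rightarrow> real \<Rightarrow> complex) \<Rightarrow> (complex \<Rightarrow> real \<Rightarrow> complex) \<Rightarrow> bool" where
  "normalizing_coordinate M f a \<longleftrightarrow>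
     continuous_on (base M) (\<lambda>(z, u). a z u) \<and>
     (\<forall>(z, u)\<in>base M. exp (4 * a z u) = f_zeta_zeta f z u) \<and>
     inj_on (\<lambda>(z, u). (a z u, u)) (base M)"

definition Zfun :: "event set \<Rightarrow> (complex \<Rightarrow> real \<Rightarrow> complex) \<Rightarrow> complex \<Rightarrow> real \<Rightarrow> complex" where
  "Zfun M a w u = (THE z. (z, u) \<in> base M \<and> a z u = w)"

definition Z_a :: "event set \<Rightarrow> (complex \<Rightarrow> real \<Rightarrow> complex) \<Rightarrow> complex \<Rightarrow> real \<Rightarrow> complex" where
  "Z_a M a w u = deriv (\<lambda>w'. Zfun M a w' u) w"

definition Z_u :: "event set \<Rightarrow> (complex \<Rightarrow> real \<Rightarrow> complex) \<Rightarrow> complex \<Rightarrow> real \<Rightarrow> complex" where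
  "Z_u M a w u = vector_derivative (\<lambda>t. Zfun M a w t) (at u)"

definition Z_uu :: "event set \<Rightarrow> (complex \<Rightarrow> real \<Rightarrow> complex) \<Rightarrow> complex \<Rightarrow> real \<Rightarrow> complex" where
  "Z_uu M a w u = vector_derivative (\<lambda>t. Z_u M a w t) (at u)"

text \<open>\<open>L\<close> is a branch of \<open>log Z\<^sub>a\<close>, as a function of \<open>(a, u)\<close>.\<close>

definition log_Z_a_branch ::
  "event set \<Rightarrow> (complex \<Rightarrow> real \<Rightarrow> complex) \<Rightarrow> (complex \<Rightarrow> real \<Rightarrow> complex) \<Rightarrow> bool" where
  "log_Z_a_branch M a L \<longleftrightarrow>
     continuous_on ((\<lambda>(z, u). (a z u, u)) ` base M) (\<lambda>(w, u). L w u) \<and>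
     (\<forall>(w, u)\<in>(\<lambda>(z, u). (a z u, u)) ` base M. exp (L w u) = Z_a M a w u)"

definition L_u :: "(complex \<Rightarrow> real \<Rightarrow> complex) \<Rightarrow> complex \<Rightarrow> real \<Rightarrow> complex" where
  "L_u L w u = vector_derivative (\<lambda>t. L w t) (at u)"


section \<open>The normalized null tetrad\<close>

definition a_at :: "(complex \<Rightarrow> real \<Rightarrow> complex) \<Rightarrow> scalar" where
  "a_at a p = a (zeta_of p) (u_of p)"

definition Zu_at :: "event set \<Rightarrow> (complex \<Rightarrow> real \<Rightarrow> complex) \<Rightarrow> scalar" where
  "Zu_at M a p = Z_u M a (a_at a p) (u_of p)"

definition omega1 :: "event set \<Rightarrow> (complex \<Rightarrow> real \<Rightarrow> complex) \<Rightarrow> event \<Rightarrow> form" where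
  "omega1 M a p X =
     exp (a_at a p - cnj (a_at a p)) * (zeta_of X - Zu_at M a p * of_real (u_of X))"

definition omega2 :: "event set \<Rightarrow> (complex \<Rightarrow> real \<Rightarrow> complex) \<Rightarrow> event \<Rightarrow> form" where
  "omega2 M a p X = cnj (omega1 M a p X)"

definition omega3 :: "(complex \<Rightarrow> real \<Rightarrow> complex) \<Rightarrow> event \<Rightarrow> form" where
  "omega3 a p X = exp (a_at a p + cnj (a_at a p)) * of_real (u_of X)"

definition omega4 ::
  "event set \<Rightarrow> (complex \<Rightarrow> real \<Rightarrow> complex) \<Rightarrow> (complex \<Rightarrow> real \<Rightarrow> complex) \<Rightarrow> event \<Rightarrow> form" where
  "omega4 M f a p X =
     exp (- a_at a p - cnj (a_at a p)) *
       ((f (zeta_of p) (u_of p) + cnj (f (zeta_of p) (u_of p))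
           + Zu_at M a p * cnj (Zu_at M a p)) * of_real (u_of X)
        + of_real (v_of X) - Zu_at M a p * cnj (zeta_of X) - cnj (Zu_at M a p) * zeta_of X)"

text \<open>The dual frame, written out in the coordinates \<open>(\<zeta>, \<zeta>\<^sup>*, u, v)\<close>.
  Lemma \<open>differential_in_tetrad\<close> confirms the duality.\<close>

definition delta_op :: "event set \<Rightarrow> (complex \<Rightarrow> real \<Rightarrow> complex) \<Rightarrow> scalar \<Rightarrow> scalar" where
  "delta_op M a Q p =
     exp (cnj (a_at a p) - a_at a p) * (d_zeta Q p + cnj (Zu_at M a p) * d_v Q p)"

definition deltastar_op :: "event set \<Rightarrow> (complex \<Rightarrow> real \<Rightarrow> complex) \<Rightarrow> scalar \<Rightarrow> scalar" where
  "deltastar_op M a Q p =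
     exp (a_at a p - cnj (a_at a p)) * (d_zetabar Q p + Zu_at M a p * d_v Q p)"

definition Delta_op ::
  "event set \<Rightarrow> (complex \<Rightarrow> real \<Rightarrow> complex) \<Rightarrow> (complex \<Rightarrow> real \<Rightarrow> complex) \<Rightarrow> scalar \<Rightarrow> scalar" where
  "Delta_op M f a Q p =
     exp (- a_at a p - cnj (a_at a p)) *
       (d_u Q p + Zu_at M a p * d_zeta Q p + cnj (Zu_at M a p) * d_zetabar Q p
        + (Zu_at M a p * cnj (Zu_at M a p)
            - f (zeta_of p) (u_of p) - cnj (f (zeta_of p) (u_of p))) * d_v Q p)"

definition D_op :: "(complex \<Rightarrow> real \<Rightarrow> complex) \<Rightarrow> scalar \<Rightarrow> scalar" where
  "D_op a Q p = exp (a_at a p + cnj (a_at a p)) * d_v Q p"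

lemma pp_metric_null_coframe:
  "pp_metric f p X =
     2 * omega1 M a p X * omega2 M a p X - 2 * omega3 a p X * omega4 M f a p X"
proof -
  define b where "b = a_at a p"
  have e1: "exp (b - cnj b) * exp (cnj b - b) = 1"
    by (simp flip: exp_add)
  have e2: "exp (b + cnj b) * exp (- b - cnj b) = 1"
    by (simp flip: exp_add)
  have "omega1 M a p X * omega2 M a p X =
      (exp (b - cnj b) * exp (cnj b - b)) *
      ((zeta_of X - Zu_at M a p * of_real (u_of X))
        * cnj (zeta_of X - Zu_at M a p * of_real (u_of X)))"
    by (simp add: omega1_def omega2_def b_def exp_cnj mult_ac)
  moreover have "omega3 a p X * omega4 M f a p X =
      (exp (b + cnj b) * exp (- b - cnj b)) * (of_real (u_of X) *
       ((f (zeta_of p) (u_of p) + cnj (f (zeta_of p) (u_of p))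
           + Zu_at M a p * cnj (Zu_at M a p)) * of_real (u_of X)
        + of_real (v_of X) - Zu_at M a p * cnj (zeta_of X) - cnj (Zu_at M a p) * zeta_of X))"
    by (simp add: omega3_def omega4_def b_def mult_ac)
  ultimately have "2 * (omega1 M a p X * omega2 M a p X) - 2 * (omega3 a p X * omega4 M f a p X)
      = pp_metric f p X"
    unfolding e1 e2 by (simp only:) (simp add: pp_metric_def algebra_simps power2_eq_square)
  then show ?thesis
    by (simp only: mult.assoc)
qed

lemma differential_in_tetrad:
  assumes "Q differentiable (at p)"
  shows "differential Q p X =
     delta_op M a Q p * omega1 M a p X + deltastar_op M a Q p * omega2 M a p X
     + Delta_op M f a Q p * omega3 a p X + D_op a Q p * omega4 M f a p X"
proof -
  define b where "b = a_at a p"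
  define Z where "Z = Zu_at M a p"
  define h where "h = f (zeta_of p) (u_of p)"
  define x y u v where "x = Re (zeta_of X)" and "y = Im (zeta_of X)"
    and "u = u_of X" and "v = v_of X"
  let ?d = "differential Q p"
  have lin: "linear ?d"
    unfolding differential_def using assms linear_frechet_derivative by blast
  have X: "X = x *\<^sub>R (1, 0, 0) + y *\<^sub>R (\<i>, 0, 0) + u *\<^sub>R (0, 1, 0) + v *\<^sub>R (0, 0, 1)"
    by (simp add: x_def y_def u_def v_def zeta_of_def u_of_def v_of_def prod_eq_iff
        complex_eq_iff)
  have z: "zeta_of X = of_real x + \<i> * of_real y"
    by (simp add: x_def y_def complex_eq_iff)
  have "?d X = x *\<^sub>R ?d (1, 0, 0) + y *\<^sub>R ?d (\<i>, 0, 0) + u *\<^sub>R ?d (0, 1, 0) + v *\<^sub>R ?d (0, 0, 1)"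
    by (subst X) (simp only: linear_add[OF lin] linear_scale[OF lin])
  then have dX: "?d X = d_zeta Q p * zeta_of X + d_zetabar Q p * cnj (zeta_of X)
      + d_u Q p * of_real u + d_v Q p * of_real v"
    by (simp add: z d_zeta_def d_zetabar_def d_u_def d_v_def scaleR_conv_of_real field_simps)
  have e: "(exp r * x) * (exp t * y) = x * y" if "r + t = 0" for r t x y :: complex
  proof -
    have "exp r * exp t = 1"
      using that by (simp flip: exp_add)
    then have "(exp r * exp t) * (x * y) = x * y"
      by simp
    then show ?thesis
      by (simp only: mult_ac)
  qed
  have 1: "delta_op M a Q p * omega1 M a p X
      = (d_zeta Q p + cnj Z * d_v Q p) * (zeta_of X - Z * of_real u)"
    unfolding delta_op_def omega1_def b_def[symmetric] Z_def[symmetric] u_def[symmetric]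
    by (rule e) simp
  have w2: "omega2 M a p X = exp (cnj b - b) * (cnj (zeta_of X) - cnj Z * of_real u)"
    by (simp add: omega1_def omega2_def exp_cnj b_def Z_def u_def)
  have 2: "deltastar_op M a Q p * omega2 M a p X
      = (d_zetabar Q p + Z * d_v Q p) * (cnj (zeta_of X) - cnj Z * of_real u)"
    unfolding deltastar_op_def w2 b_def[symmetric] Z_def[symmetric] by (rule e) simp
  have 3: "Delta_op M f a Q p * omega3 a p X
      = (d_u Q p + Z * d_zeta Q p + cnj Z * d_zetabar Q p + (Z * cnj Z - h - cnj h) * d_v Q p)
        * of_real u"
    unfolding Delta_op_def omega3_def b_def[symmetric] Z_def[symmetric] u_def[symmetric]
      h_def[symmetric]
    by (rule e) simp
  have 4: "D_op a Q p * omega4 M f a p X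
      = d_v Q p * ((h + cnj h + Z * cnj Z) * of_real u + of_real v - Z * cnj (zeta_of X)
          - cnj Z * zeta_of X)"
    unfolding D_op_def omega4_def b_def[symmetric] Z_def[symmetric] u_def[symmetric]
      v_def[symmetric] h_def[symmetric]
    by (rule e) simp
  show ?thesis
    unfolding dX 1 2 3 4 by (simp add: algebra_simps)
qed


section \<open>Spin coefficients and invariants\<close>

definition alpha :: "(complex \<Rightarrow> real \<Rightarrow> complex) \<Rightarrow> scalar" where
  "alpha a p =
     exp (a_at a p - cnj (a_at a p)) * cnj (deriv (\<lambda>z. a z (u_of p)) (zeta_of p))"

definition alphastar :: "(complex \<Rightarrow> real \<Rightarrow> complex) \<Rightarrow> scalar" where
  "alphastar a p = cnj (alpha a p)"

definition mu ::
  "(complex \<Rightarrow> real \<Rightarrow> complex) \<Rightarrow> (complex \<Rightarrow> real \<Rightarrow> complex) \<Rightarrow> scalar" where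
  "mu a L p = exp (- a_at a p - cnj (a_at a p)) * L_u L (a_at a p) (u_of p)"

definition nu ::
  "event set \<Rightarrow> (complex \<Rightarrow> real \<Rightarrow> complex) \<Rightarrow> (complex \<Rightarrow> real \<Rightarrow> complex) \<Rightarrow> scalar" where
  "nu M f a p =
     exp (- a_at a p - 3 * cnj (a_at a p)) *
       (Z_uu M a (a_at a p) (u_of p) + cnj (f_zeta f (zeta_of p) (u_of p)))"

definition A_inv :: "event set \<Rightarrow> (complex \<Rightarrow> real \<Rightarrow> complex) \<Rightarrow> scalar" where
  "A_inv M a p = deltastar_op M a (alpha a) p / (alpha a p)\<^sup>2"

definition Y_inv ::
  "event set \<Rightarrow> (complex \<Rightarrow> real \<Rightarrow> complex) \<Rightarrow> (complex \<Rightarrow> real \<Rightarrow> complex)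
     \<Rightarrow> (complex \<Rightarrow> real \<Rightarrow> complex) \<Rightarrow> scalar" where
  "Y_inv M f a L p =
     (3 - A_inv M a p) * nu M f a p - 1 / alpha a p
     + (Delta_op M f a (mu a L) p + (mu a L p)\<^sup>2) / alphastar a p"

definition type_0_2 :: "event set \<Rightarrow> (complex \<Rightarrow> real \<Rightarrow> complex) \<Rightarrow> bool" where
  "type_0_2 M a \<longleftrightarrow>
     (\<forall>p\<in>M. \<exists>X W. wedge2 (differential (alpha a) p) (differential (alphastar a) p) X W \<noteq> 0)"

text \<open>A holomorphic branch of the logarithm on a set of complex numbers.\<close>

definition log_branch :: "complex set \<Rightarrow> (complex \<Rightarrow> complex) \<Rightarrow> bool" where
  "log_branch S lg \<longleftrightarrow> lg holomorphic_on S \<and> (\<forall>z\<in>S. exp (lg z) = z)"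

end

theory Submission
  imports Defs
begin

text \<open>Near a given point \<open>4 a = log f\<^sub>\<zeta>\<^sub>\<zeta>\<close> reads \<open>a = (k - log \<zeta>)/2\<close> for a smooth
  function \<open>k\<close> of \<open>u\<close> with \<open>exp (2 k) = - g\<^sub>1\<close>, so \<open>Z = exp (k - 2 a)\<close>.  Consequently
  \<open>\<alpha> = - exp (a + a\<^sup>* - k\<^sup>*)/2\<close>, \<open>A = 1\<close>, \<open>\<mu> = exp (- a - a\<^sup>*) k'\<close>, and \<open>\<nu>\<close> is a function
  of \<open>a + a\<^sup>*\<close> and \<open>u\<close> plus \<open>g\<^sub>2\<^sup>* exp (- a - 3 a\<^sup>*)\<close>; the first part cancels in
  \<open>Y = 2 g\<^sub>2\<^sup>* exp (- a - 3 a\<^sup>*)\<close>.  Type \<open>(0,2)\<close> means that \<open>k'\<close> is nowhere real, in which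
  case \<open>d\<alpha>\<close> and \<open>d\<alpha>\<^sup>*\<close> span \<open>d(a + a\<^sup>*)\<close> and \<open>du\<close>, so that \<open>d\<alpha> \<and> d\<alpha>\<^sup>* \<and> d\<nu>\<close> is a
  nowhere vanishing multiple of \<open>g\<^sub>2\<^sup>*\<close>.  All three conditions are thus equivalent at each
  point separately.\<close>

section \<open>Logarithms and smooth coefficients\<close>

lemma open_base:
  assumes "open M"
  shows "open (base M)"
  unfolding base_def
proof (rule open_surjective_linear_image[OF assms])
  show "linear (\<lambda>p. (zeta_of p, u_of p))"
    by (rule linearI) (auto simp: zeta_of_def u_of_def)
  show "surj (\<lambda>p. (zeta_of p, u_of p))"
  proof (rule surjI)
    show "(zeta_of (fst q, snd q, 0), u_of (fst q, snd q, 0)) = q" for q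
      by (simp add: zeta_of_def u_of_def)
  qed
qed

lemma fst_image_base: "fst ` base M = zeta_of ` M"
  by (force simp: base_def)

lemma snd_image_base: "snd ` base M = u_of ` M"
  by (force simp: base_def)

text \<open>Differentiating \<open>exp (lg w) = w\<close> gives \<open>z * D = 1\<close> for the
  derivative \<open>D\<close>, whichever branch \<open>lg\<close> is.\<close>

lemma log_branch_has_field_derivative:
  assumes "open S" "log_branch S lg" "z \<in> S"
  shows "(lg has_field_derivative 1 / z) (at z)"
proof -
  obtain D where D: "(lg has_field_derivative D) (at z)"
    using assms unfolding log_branch_def
    by (metis holomorphic_on_imp_differentiable_at field_differentiable_def)
  then have "((\<lambda>w. exp (lg w)) has_field_derivative exp (lg z) * D) (at z)"
    by (auto intro!: derivative_eq_intros)
  then have "((\<lambda>w. w) has_field_derivative exp (lg z) * D) (at z)"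
    by (rule has_field_derivative_transform_within_open[OF _ assms(1,3)])
       (use assms in \<open>auto simp: log_branch_def\<close>)
  then have "exp (lg z) * D = 1"
    using DERIV_ident DERIV_unique by blast
  then have "z * D = 1"
    using assms by (auto simp: log_branch_def)
  then have "D = 1 / z"
    by (auto simp: eq_divide_eq mult.commute)
  with D show ?thesis by simp
qed

text \<open>Two continuous logarithms of one function differ by a multiple of 2 pi i, so agreement
  at \<open>x\<close> persists as long as their imaginary parts stay less than 2 pi apart. It serves
  to match branches of logarithms near a point.\<close>

lemma eq_nearby_of_exp_eq:
  fixes \<phi> \<psi> :: "'a::topological_space \<Rightarrow> complex"
  assumes U: "open U" "x \<in> U" and cont: "continuous_on U \<phi>" "continuous_on U \<psi>"
    and eq: "\<phi> x = \<psi> x" and exp_eq: "\<And>y. y \<in> U \<Longrightarrow> exp (\<phi> y) = exp (\<psi> y)"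
  obtains V where "open V" "x \<in> V" "V \<subseteq> U" "\<And>y. y \<in> V \<Longrightarrow> \<phi> y = \<psi> y"
proof
  let ?V = "U \<inter> (\<lambda>y. Im (\<phi> y) - Im (\<psi> y)) -` {- 2 * pi<..<2 * pi}"
  show "open ?V"
  proof (rule continuous_open_preimage[OF _ U(1) open_greaterThanLessThan])
    show "continuous_on U (\<lambda>y. Im (\<phi> y) - Im (\<psi> y))"
      by (intro continuous_on_diff continuous_on_Im cont)
  qed
  show "x \<in> ?V" using U eq by simp
  show "\<phi> y = \<psi> y" if "y \<in> ?V" for y
    using that exp_eq[of y] by (auto intro!: exp_complex_eqI[of "\<phi> y" "\<psi> y"])
qed auto

text \<open>If the determinant vanished on all of \<open>U\<close>, its derivative in
  \<open>y\<close> at \<open>y = x\<close>, namely \<open>lg x - 1\<close>, would vanish too. Then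
  \<open>lg\<close> would be constantly 1, and \<open>U\<close> would reduce to the single point
  \<open>exp 1\<close>, which is not open.\<close>

lemma exists_log_independent_points:
  assumes S: "open S" "log_branch S lg" and U: "open U" "U \<subseteq> S" "z0 \<in> U"
  obtains x y where "x \<in> U" "y \<in> U" "lg x * y - lg y * x \<noteq> 0"
proof (rule ccontr)
  assume "\<not> thesis"
  with that have *: "lg x * y - lg y * x = 0" if "x \<in> U" "y \<in> U" for x y
    using that by blast
  have "lg x = 1" if x: "x \<in> U" for x
  proof -
    have "x \<noteq> 0"
      using x U S by (metis exp_not_eq_zero log_branch_def subsetD)
    have "((\<lambda>y. lg x * y - lg y * x) has_field_derivative lg x - 1) (at x)"
      using log_branch_has_field_derivative[OF S, of x] x U \<open>x \<noteq> 0\<close>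
      by (auto intro!: derivative_eq_intros)
    then have "((\<lambda>y. 0) has_field_derivative lg x - 1) (at x)"
      by (rule has_field_derivative_transform_within_open[OF _ U(1) x]) (use * x in auto)
    then show ?thesis
      using DERIV_unique[OF _ DERIV_const] by fastforce
  qed
  then have "x = exp 1" if "x \<in> U" for x
    using that U S by (metis log_branch_def subsetD)
  then have "U = {exp 1}" using U by blast
  then show False
    using U not_open_singleton by metis
qed

text \<open>The coefficients are recovered from the values of \<open>f\<close> at two fixed points \<open>\<zeta>\<close> by
  solving a linear system, so they inherit smoothness in \<open>u\<close>.\<close>

lemma coefficients_smooth:
  assumes B: "open B" "(z0, u0) \<in> B" "analytic_smooth B f"
    and S: "open S" "log_branch S lg" "fst ` B \<subseteq> S"
    and f: "\<And>z u. (z, u) \<in> B \<Longrightarrow> f z u = g1 u * lg z + g2 u * z"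
  obtains G H N where "open N" "u0 \<in> N" "\<And>t. t \<in> N \<Longrightarrow> G 0 t = g1 t" "\<And>t. t \<in> N \<Longrightarrow> H 0 t = g2 t"
    "\<And>n t. t \<in> N \<Longrightarrow> (G n has_vector_derivative G (Suc n) t) (at t)"
    "\<And>n t. t \<in> N \<Longrightarrow> (H n has_vector_derivative H (Suc n) t) (at t)"
proof -
  obtain F where F0: "\<And>z u. (z, u) \<in> B \<Longrightarrow> F 0 z u = f z u"
    and F: "\<And>n z u. (z, u) \<in> B \<Longrightarrow> ((\<lambda>t. F n z t) has_vector_derivative F (Suc n) z u) (at u)"
    using B(3) unfolding analytic_smooth_def by fast
  obtain U N where UN: "open U" "open N" "z0 \<in> U" "u0 \<in> N" "U \<times> N \<subseteq> B"
    by (rule open_prod_elim[OF B(1,2)]) auto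
  then have "U \<subseteq> S"
    using S by force
  then obtain x y where xy: "x \<in> U" "y \<in> U" "lg x * y - lg y * x \<noteq> 0"
    using exists_log_independent_points[OF S(1,2) UN(1) _ UN(3)] by blast
  \<comment> \<open>The determinant of the system for \<open>g1 t\<close> and \<open>g2 t\<close>
    with rows \<open>(lg x, x)\<close> and \<open>(lg y, y)\<close>. \<open>G n\<close> and
    \<open>H n\<close> are Cramer's rule with right-hand sides \<open>F n x t\<close> and
    \<open>F n y t\<close>; as \<open>x\<close> and \<open>y\<close> are fixed, the weights are
    constant in \<open>t\<close> and the rule passes to every derivative.\<close>
  define d where "d = lg x * y - lg y * x"
  have d: "d \<noteq> 0" using xy by (simp add: d_def)
  define G where "G n t = (y / d) * F n x t - (x / d) * F n y t" for n t
  define H where "H n t = (lg x / d) * F n y t - (lg y / d) * F n x t" for n t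
  have mem: "(x, t) \<in> B" "(y, t) \<in> B" if "t \<in> N" for t
    using that xy UN by auto
  show thesis
  proof (rule that[of N G H])
    fix t assume t: "t \<in> N"
    have "d * G 0 t = d * g1 t"
      using d by (simp add: G_def F0 f mem[OF t] field_simps) (simp add: d_def algebra_simps)
    then show "G 0 t = g1 t"
      using d by simp
    have "d * H 0 t = d * g2 t"
      using d by (simp add: H_def F0 f mem[OF t] field_simps) (simp add: d_def algebra_simps)
    then show "H 0 t = g2 t"
      using d by simp
  next
    fix n t assume t: "t \<in> N"
    show "(G n has_vector_derivative G (Suc n) t) (at t)"
      unfolding G_def by (intro has_vector_derivative_diff has_vector_derivative_mult_right F mem t)
    show "(H n has_vector_derivative H (Suc n) t) (at t)"
      unfolding H_def by (intro has_vector_derivative_diff has_vector_derivative_mult_right F mem t)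
  qed (use UN in auto)
qed

lemma has_vector_derivative_quotient:
  fixes f g :: "real \<Rightarrow> complex"
  assumes "(f has_vector_derivative f') (at t)" "(g has_vector_derivative g') (at t)" "g t \<noteq> 0"
  shows "((\<lambda>t. f t / g t) has_vector_derivative (f' * g t - f t * g') / (g t)\<^sup>2) (at t)"
proof -
  have "((\<lambda>t. inverse (g t)) has_vector_derivative g' * (- inverse (g t ^ 2))) (at t)"
    using field_vector_diff_chain_at[OF assms(2) DERIV_inverse[OF assms(3)]]
    by (simp add: o_def power2_eq_square)
  then have "((\<lambda>t. f t * inverse (g t)) has_vector_derivative
      f t * (g' * (- inverse (g t ^ 2))) + f' * inverse (g t)) (at t)"
    by (rule has_vector_derivative_mult[OF assms(1)])
  moreover have "f t * (g' * (- inverse (g t ^ 2))) + f' * inverse (g t)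
      = (f' * g t - f t * g') / (g t)\<^sup>2"
    using assms(3) by (simp add: power2_eq_square divide_simps)
  ultimately show ?thesis
    by (simp only: divide_inverse)
qed

text \<open>\<open>k\<close> is half a logarithm of \<open>- G 0\<close> with prescribed value
  \<open>c\<close> at \<open>u0\<close>. Three derivatives are provided: two enter the second
  derivative of \<open>Z\<close>, hence \<open>nu\<close>, and the third enters the differential of
  \<open>nu\<close>.\<close>

lemma smooth_half_log:
  fixes G :: "nat \<Rightarrow> real \<Rightarrow> complex"
  assumes N: "open N" "u0 \<in> N"
    and G: "\<And>n t. t \<in> N \<Longrightarrow> (G n has_vector_derivative G (Suc n) t) (at t)"
    and nz: "\<And>t. t \<in> N \<Longrightarrow> G 0 t \<noteq> 0"
    and c: "exp (2 * c) = - G 0 u0"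
  obtains k k1 k2 k3 N' where "open N'" "u0 \<in> N'" "N' \<subseteq> N" "k u0 = c"
    "\<And>t. t \<in> N' \<Longrightarrow> exp (2 * k t) = - G 0 t"
    "\<And>t. t \<in> N' \<Longrightarrow> (k has_vector_derivative k1 t) (at t)"
    "\<And>t. t \<in> N' \<Longrightarrow> (k1 has_vector_derivative k2 t) (at t)"
    "\<And>t. t \<in> N' \<Longrightarrow> (k2 has_vector_derivative k3 t) (at t)"
proof -
  \<comment> \<open>Dividing by \<open>G 0 u0\<close> moves the value at \<open>u0\<close> to 1,
    away from the cut of \<open>Ln\<close>; near \<open>u0\<close> the principal branch is therefore
    smooth, and the constant \<open>c\<close> restores the wanted branch.\<close>
  define q where "q t = G 0 t / G 0 u0" for t
  have q: "(q has_vector_derivative G 1 t / G 0 u0) (at t)" if "t \<in> N" for t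
    using has_vector_derivative_divide[OF G[OF that, of 0]] by (simp add: q_def[abs_def])
  have "continuous_on N q"
    using q by (meson N(1) continuous_at_imp_continuous_on has_vector_derivative_continuous)
  moreover have "open (- \<real>\<^sub>\<le>\<^sub>0 :: complex set)"
    by (simp add: open_Compl)
  ultimately have op: "open (N \<inter> q -` (- \<real>\<^sub>\<le>\<^sub>0))"
    using N by (metis continuous_on_open_vimage Int_commute)
  define N' where "N' = N \<inter> q -` (- \<real>\<^sub>\<le>\<^sub>0)"
  define k where "k t = c + Ln (q t) / 2" for t
  define k1 where "k1 t = G 1 t / (2 * G 0 t)" for t
  define k2 where "k2 t = (G 2 t * G 0 t - G 1 t * G 1 t) / (2 * (G 0 t)\<^sup>2)" for t
  define k3 where "k3 t = vector_derivative k2 (at t)" for t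
  have G0: "G 0 u0 \<noteq> 0" using nz N by blast
  have G1: "(G 0 has_vector_derivative G 1 t) (at t)" "(G 1 has_vector_derivative G 2 t) (at t)"
    "(G 2 has_vector_derivative G 3 t) (at t)" if "t \<in> N" for t
    using G[OF that, of 0] G[OF that, of 1] G[OF that, of 2] by (simp_all add: numeral_eq_Suc)
  show thesis
  proof (rule that[of N' k k1 k2 k3])
    show "open N'" "N' \<subseteq> N" using op by (auto simp: N'_def)
    show "u0 \<in> N'" using N G0 by (auto simp: N'_def q_def)
    show "k u0 = c" using G0 by (simp add: k_def q_def)
  next
    fix t assume "t \<in> N'"
    then have t: "t \<in> N" "q t \<notin> \<real>\<^sub>\<le>\<^sub>0" by (auto simp: N'_def)
    then have nzt: "G 0 t \<noteq> 0" "q t \<noteq> 0" using nz by auto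
    show "exp (2 * k t) = - G 0 t"
      using nzt G0 c by (simp add: k_def exp_add algebra_simps) (simp add: q_def)
    have "((\<lambda>t. Ln (q t)) has_vector_derivative (G 1 t / G 0 u0) * inverse (q t)) (at t)"
      using field_vector_diff_chain_at[OF q[OF t(1)] has_field_derivative_Ln[OF t(2)]]
      by (simp add: o_def)
    then have "((\<lambda>t. c + Ln (q t) / 2) has_vector_derivative 0 + (G 1 t / G 0 u0) * inverse (q t) / 2) (at t)"
      by (intro has_vector_derivative_add has_vector_derivative_const has_vector_derivative_divide)
    then show "(k has_vector_derivative k1 t) (at t)"
      using nzt G0 by (simp add: k_def[abs_def] k1_def q_def field_simps)
    show "(k1 has_vector_derivative k2 t) (at t)"
    proof -
      have "(k1 has_vector_derivative (G 2 t * (2 * G 0 t) - G 1 t * (2 * G 1 t)) / (2 * G 0 t)\<^sup>2) (at t)"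
        unfolding k1_def[abs_def] using nzt
        by (intro has_vector_derivative_quotient has_vector_derivative_mult_right G1 t(1)) auto
      moreover have "(G 2 t * (2 * G 0 t) - G 1 t * (2 * G 1 t)) / (2 * G 0 t)\<^sup>2 = k2 t"
        using nzt by (simp add: k2_def power2_eq_square divide_simps)
      ultimately show ?thesis by (simp only:)
    qed
    have "k2 differentiable at t"
      unfolding k2_def[abs_def] power2_eq_square
      by (rule differentiableI_vector, rule has_vector_derivative_quotient,
          (rule has_vector_derivative_diff has_vector_derivative_mult
            has_vector_derivative_const G1 t(1))+)
        (use nzt in auto)
    then show "(k2 has_vector_derivative k3 t) (at t)"
      unfolding k3_def by (simp add: vector_derivative_works)
  qed
qed

section \<open>The invariants in a logarithmic chart\<close>

lemma has_derivative_exp_comp: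
  fixes \<phi> :: "'a::real_normed_vector \<Rightarrow> complex"
  assumes "(\<phi> has_derivative \<phi>') (at p)"
  shows "((\<lambda>q. exp (\<phi> q)) has_derivative (\<lambda>X. exp (\<phi> p) * \<phi>' X)) (at p)"
  using has_derivative_compose[OF assms DERIV_exp[unfolded has_field_derivative_def]]
  by (simp add: o_def)

lemma differential_eqI:
  "(Q has_derivative Q') (at p) \<Longrightarrow> differential Q p = Q'"
  by (simp add: differential_def frechet_derivative_at[symmetric])

lemma bounded_linear_zeta_of: "bounded_linear zeta_of"
  unfolding zeta_of_def[abs_def] by (rule bounded_linear_fst)

lemma bounded_linear_u_of: "bounded_linear u_of"
  unfolding u_of_def[abs_def]
  by (rule bounded_linear_compose[OF bounded_linear_fst bounded_linear_snd])

lemma has_derivative_comp_u_of: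
  fixes g :: "real \<Rightarrow> complex"
  assumes "(g has_vector_derivative g') (at (u_of p))"
  shows "((\<lambda>q. g (u_of q)) has_derivative (\<lambda>X. of_real (u_of X) * g')) (at p)"
  using has_derivative_compose[OF bounded_linear_imp_has_derivative[OF bounded_linear_u_of]
      assms[unfolded has_vector_derivative_def]]
  by (simp add: scaleR_conv_of_real)

lemma has_derivative_comp_zeta_of:
  fixes g :: "complex \<Rightarrow> complex"
  assumes "(g has_field_derivative g') (at (zeta_of p))"
  shows "((\<lambda>q. g (zeta_of q)) has_derivative (\<lambda>X. g' * zeta_of X)) (at p)"
  using has_derivative_compose[OF bounded_linear_imp_has_derivative[OF bounded_linear_zeta_of]
      assms[unfolded has_field_derivative_def]]
  by simp

text \<open>The first two forms lie in the span of \<open>b + b'\<close> and \<open>u\<close>, and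
  their product is \<open>c * c' * (l' - l)\<close> times that of \<open>b + b'\<close> and
  \<open>u\<close>. The terms with \<open>P\<close> and \<open>Q\<close> are thus killed, and only
  the coefficient of \<open>b'\<close> in the third form survives.\<close>

lemma wedge3_linear_combination:
  "wedge3 (\<lambda>X. c * (b X + b' X - u X * l')) (\<lambda>X. c' * (b X + b' X - u X * l))
      (\<lambda>X. P * (b X + b' X) + Q * u X - R * b' X) X V W
    = - c * c' * (l' - l) * R * wedge3 b u b' X V W"
  unfolding wedge3_def wedge2_def by algebra

text \<open>\<open>M\<close> may be so large that \<open>\<zeta> exp (2 a)\<close>, a square root of \<open>- g\<^sub>1\<close>, takes both signs over
  one value of \<open>u\<close>; hence the normal form of \<open>a\<close> is required on a neighbourhood \<open>U\<close> only.\<close>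

locale log_chart =
  fixes M :: "event set" and f a L :: "complex \<Rightarrow> real \<Rightarrow> complex" and lg :: "complex \<Rightarrow> complex"
    and g2 g2' k k1 k2 k3 :: "real \<Rightarrow> complex" and U :: "(complex \<times> real) set"
  assumes open_U: "open U"
    and exp_lg: "(z, t) \<in> U \<Longrightarrow> exp (lg z) = z"
    and lg_deriv: "(z, t) \<in> U \<Longrightarrow> (lg has_field_derivative 1 / z) (at z)"
    and k_deriv: "(z, t) \<in> U \<Longrightarrow> (k has_vector_derivative k1 t) (at t)"
    and k1_deriv: "(z, t) \<in> U \<Longrightarrow> (k1 has_vector_derivative k2 t) (at t)"
    and k2_deriv: "(z, t) \<in> U \<Longrightarrow> (k2 has_vector_derivative k3 t) (at t)"
    and g2_deriv: "(z, t) \<in> U \<Longrightarrow> (g2 has_vector_derivative g2' t) (at t)"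
    and a_eq: "(z, t) \<in> U \<Longrightarrow> a z t = (k t - lg z) / 2"
    and f_zeta_eq: "(z, t) \<in> U \<Longrightarrow> f_zeta f z t = g2 t - exp (2 * k t) / z"
    and Z_u_eq: "(z, t) \<in> U \<Longrightarrow> Z_u M a (a z t) t = k1 t * z"
    and Z_uu_eq: "(z, t) \<in> U \<Longrightarrow> Z_uu M a (a z t) t = (k2 t + (k1 t)\<^sup>2) * z"
    and L_u_eq: "(z, t) \<in> U \<Longrightarrow> L_u L (a z t) t = k1 t"
begin

definition chart :: "event set" where
  "chart = {p. (zeta_of p, u_of p) \<in> U}"

lemma open_chart: "open chart"
proof -
  have "chart = (\<lambda>p. (zeta_of p, u_of p)) -` U"
    by (auto simp: chart_def)
  also have "open \<dots>"
    by (rule open_vimage[OF open_U], intro continuous_on_Pair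
        linear_continuous_on[OF bounded_linear_zeta_of] linear_continuous_on[OF bounded_linear_u_of])
  finally show ?thesis .
qed

definition da :: "event \<Rightarrow> form" where
  "da p X = (of_real (u_of X) * k1 (u_of p) - zeta_of X / zeta_of p) / 2"

lemma a_at_has_derivative:
  assumes p: "p \<in> chart"
  shows "(a_at a has_derivative da p) (at p)"
proof (rule has_derivative_transform_within_open[OF _ open_chart p])
  have in_U: "(zeta_of p, u_of p) \<in> U" using p by (simp add: chart_def)
  have "((\<lambda>q. (k (u_of q) - lg (zeta_of q)) / 2) has_derivative
      (\<lambda>X. (of_real (u_of X) * k1 (u_of p) - 1 / zeta_of p * zeta_of X) / 2)) (at p)"
    by (intro bounded_linear.has_derivative[OF bounded_linear_divide] has_derivative_diff
        has_derivative_comp_u_of has_derivative_comp_zeta_of k_deriv[OF in_U] lg_deriv[OF in_U])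
  then show "((\<lambda>q. (k (u_of q) - lg (zeta_of q)) / 2) has_derivative da p) (at p)"
    by (simp add: da_def[abs_def])
qed (simp add: chart_def a_at_def a_eq)

section \<open>Closed forms of the spin coefficients in terms of \<open>a\<close>, its conjugate and
  \<open>u\<close>\<close>

lemma zeta_eq:
  assumes "p \<in> chart"
  shows "zeta_of p = exp (k (u_of p) - 2 * a_at a p)"
proof -
  have U: "(zeta_of p, u_of p) \<in> U" using assms by (simp add: chart_def)
  have "k (u_of p) - 2 * a_at a p = lg (zeta_of p)"
    by (simp add: a_at_def a_eq[OF U] field_simps)
  then show ?thesis by (simp add: exp_lg[OF U])
qed

lemma zeta_nz: "p \<in> chart \<Longrightarrow> zeta_of p \<noteq> 0"
  by (simp add: zeta_eq)

lemma deriv_a: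
  assumes in_U: "(z, t) \<in> U"
  shows "deriv (\<lambda>w. a w t) z = - 1 / (2 * z)"
proof (rule DERIV_imp_deriv, rule has_field_derivative_transform_within_open)
  show "open ((\<lambda>w. (w, t)) -` U)"
    by (rule open_vimage[OF open_U]) (intro continuous_intros)
  have "((\<lambda>w. (k t - lg w) / 2) has_field_derivative (0 - 1 / z) / 2) (at z)"
    by (intro DERIV_cdivide DERIV_diff DERIV_const lg_deriv[OF in_U])
  then show "((\<lambda>w. (k t - lg w) / 2) has_field_derivative - 1 / (2 * z)) (at z)"
    by (simp add: mult.commute)
  show "z \<in> (\<lambda>w. (w, t)) -` U"
    using in_U by simp
  show "(k t - lg w) / 2 = a w t" if "w \<in> (\<lambda>w. (w, t)) -` U" for w
    using that a_eq[of w t] by simp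
qed

lemma alpha_eq:
  assumes p: "p \<in> chart"
  shows "alpha a p = - (1 / 2) * exp (a_at a p + cnj (a_at a p) - cnj (k (u_of p)))"
proof -
  have "alpha a p = exp (a_at a p - cnj (a_at a p)) * (- 1 / (2 * cnj (zeta_of p)))"
    using p by (simp add: alpha_def chart_def deriv_a)
  also have "\<dots> = - (1 / 2) * (exp (a_at a p - cnj (a_at a p)) / cnj (zeta_of p))"
    by simp
  \<comment> \<open>Dividing by the conjugate of \<open>exp (k - 2 * a)\<close> flips the sign of
    the conjugate of \<open>a\<close> in the exponent, so \<open>alpha\<close> depends on
    \<open>a\<close> only through its real part.\<close>
  also have "exp (a_at a p - cnj (a_at a p)) / cnj (zeta_of p)
      = exp (a_at a p + cnj (a_at a p) - cnj (k (u_of p)))"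
    unfolding zeta_eq[OF p] exp_cnj exp_diff[symmetric] by (simp add: algebra_simps)
  finally show ?thesis .
qed

lemma mu_eq:
  "p \<in> chart \<Longrightarrow> mu a L p = exp (- a_at a p - cnj (a_at a p)) * k1 (u_of p)"
  using L_u_eq[of "zeta_of p" "u_of p"] by (simp add: mu_def chart_def a_at_def)

lemma Zu_at_eq: "p \<in> chart \<Longrightarrow> Zu_at M a p = k1 (u_of p) * zeta_of p"
  using Z_u_eq[of "zeta_of p" "u_of p"] by (simp add: Zu_at_def chart_def a_at_def)

text \<open>The terms are grouped by their dependence: the first two involve only the sum of
  \<open>a\<close> and its conjugate, and \<open>u\<close>; the \<open>g2\<close> term is the only
  one that sees \<open>a\<close> and its conjugate separately.\<close>

lemma nu_eq:
  assumes p: "p \<in> chart"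
  shows "nu M f a p =
    exp (- 3 * (a_at a p + cnj (a_at a p)) + k (u_of p)) * (k2 (u_of p) + k1 (u_of p) * k1 (u_of p))
    - exp (- (a_at a p + cnj (a_at a p)) + cnj (k (u_of p)))
    + exp (- a_at a p - 3 * cnj (a_at a p)) * cnj (g2 (u_of p))"
proof -
  let ?a = "a_at a p" and ?k = "k (u_of p)"
  have in_U: "(zeta_of p, u_of p) \<in> U" using p by (simp add: chart_def)
  have "exp (2 * ?k) / zeta_of p = exp (?k + 2 * ?a)"
    unfolding zeta_eq[OF p] exp_diff[symmetric] by (simp add: algebra_simps)
  then have "nu M f a p = exp (- ?a - 3 * cnj ?a) *
      ((k2 (u_of p) + (k1 (u_of p))\<^sup>2) * zeta_of p + cnj (g2 (u_of p)) - exp (cnj ?k + 2 * cnj ?a))"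
    using Z_uu_eq[OF in_U] f_zeta_eq[OF in_U] by (simp add: nu_def a_at_def exp_cnj)
  also have "\<dots> = (exp (- ?a - 3 * cnj ?a) * zeta_of p) * (k2 (u_of p) + (k1 (u_of p))\<^sup>2)
      - exp (- ?a - 3 * cnj ?a) * exp (cnj ?k + 2 * cnj ?a) + exp (- ?a - 3 * cnj ?a) * cnj (g2 (u_of p))"
    by (simp add: algebra_simps)
  also have "exp (- ?a - 3 * cnj ?a) * zeta_of p = exp (- 3 * (?a + cnj ?a) + ?k)"
    unfolding zeta_eq[OF p] exp_add[symmetric] by (simp add: algebra_simps)
  also have "exp (- ?a - 3 * cnj ?a) * exp (cnj ?k + 2 * cnj ?a) = exp (- (?a + cnj ?a) + cnj ?k)"
    unfolding exp_add[symmetric] by (simp add: algebra_simps)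
  finally show ?thesis by (simp add: power2_eq_square)
qed

section \<open>Differentials and invariants at one point of the chart\<close>

context
  fixes p assumes p: "p \<in> chart"
begin

lemma in_U: "(zeta_of p, u_of p) \<in> U"
  using p by (simp add: chart_def)

lemmas basic_derivs =
  a_at_has_derivative[OF p]
  bounded_linear.has_derivative[OF bounded_linear_cnj a_at_has_derivative[OF p]]
  has_derivative_comp_u_of[OF k_deriv[OF in_U]]
  bounded_linear.has_derivative[OF bounded_linear_cnj has_derivative_comp_u_of[OF k_deriv[OF in_U]]]
  has_derivative_comp_u_of[OF k1_deriv[OF in_U]]
  has_derivative_comp_u_of[OF k2_deriv[OF in_U]]
  bounded_linear.has_derivative[OF bounded_linear_cnj has_derivative_comp_u_of[OF g2_deriv[OF in_U]]]

lemma alpha_has_derivative: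
  "(alpha a has_derivative
     (\<lambda>X. alpha a p * (da p X + cnj (da p X) - of_real (u_of X) * cnj (k1 (u_of p))))) (at p)"
proof -
  have "((\<lambda>q. - (1 / 2) * exp (a_at a q + cnj (a_at a q) - cnj (k (u_of q)))) has_derivative
      (\<lambda>X. - (1 / 2) * (exp (a_at a p + cnj (a_at a p) - cnj (k (u_of p))) *
        (da p X + cnj (da p X) - cnj (of_real (u_of X) * k1 (u_of p)))))) (at p)"
    by (intro has_derivative_mult_right has_derivative_exp_comp has_derivative_add has_derivative_diff
        basic_derivs)
  then have "(alpha a has_derivative
      (\<lambda>X. - (1 / 2) * (exp (a_at a p + cnj (a_at a p) - cnj (k (u_of p))) *
        (da p X + cnj (da p X) - cnj (of_real (u_of X) * k1 (u_of p)))))) (at p)"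
    by (rule has_derivative_transform_within_open[OF _ open_chart p]) (simp add: alpha_eq)
  then show ?thesis
    by (simp add: alpha_eq[OF p])
qed

lemmas differential_alpha = differential_eqI[OF alpha_has_derivative]

lemma differential_alphastar:
  "differential (alphastar a) p =
     (\<lambda>X. cnj (alpha a p) * (da p X + cnj (da p X) - of_real (u_of X) * k1 (u_of p)))"
  using differential_eqI[OF bounded_linear.has_derivative[OF bounded_linear_cnj alpha_has_derivative]]
  by (simp add: alphastar_def[abs_def] add.commute)

lemma differential_mu:
  "differential (mu a L) p X = exp (- a_at a p - cnj (a_at a p)) *
     (of_real (u_of X) * k2 (u_of p) - k1 (u_of p) * (da p X + cnj (da p X)))"
proof -
  let ?e = "\<lambda>q. exp (- a_at a q - cnj (a_at a q))"
  have "((\<lambda>q. ?e q * k1 (u_of q)) has_derivative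
      (\<lambda>X. ?e p * (of_real (u_of X) * k2 (u_of p)) + ?e p * (- da p X - cnj (da p X)) * k1 (u_of p))) (at p)"
    by (intro has_derivative_mult has_derivative_exp_comp has_derivative_minus has_derivative_diff
        basic_derivs)
  then have "(mu a L has_derivative
      (\<lambda>X. ?e p * (of_real (u_of X) * k2 (u_of p)) + ?e p * (- da p X - cnj (da p X)) * k1 (u_of p))) (at p)"
    by (rule has_derivative_transform_within_open[OF _ open_chart p]) (simp add: mu_eq)
  from differential_eqI[OF this] show ?thesis
    by (simp add: algebra_simps)
qed

text \<open>The exponent of the \<open>g2\<close> term has differential
  \<open>- da - 3 * cnj da\<close>, which is \<open>- (da + cnj da) - 2 * cnj da\<close>; this is
  the source of the factor 2. \<open>P\<close> and \<open>Q\<close> stay unspecified because they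
  drop out of the product with the differentials of \<open>alpha\<close> and
  \<open>alphastar\<close>.\<close>

lemma differential_nu:
  obtains P Q where "\<And>X. differential (nu M f a) p X =
     P * (da p X + cnj (da p X)) + Q * of_real (u_of X)
     - 2 * exp (- a_at a p - 3 * cnj (a_at a p)) * cnj (g2 (u_of p)) * cnj (da p X)"
proof -
  let ?s = "\<lambda>q. a_at a q + cnj (a_at a q)"
  let ?e1 = "\<lambda>q. exp (- 3 * ?s q + k (u_of q))" and ?h = "\<lambda>q. k2 (u_of q) + k1 (u_of q) * k1 (u_of q)"
  let ?e2 = "\<lambda>q. exp (- ?s q + cnj (k (u_of q)))"
  let ?e3 = "\<lambda>q. exp (- a_at a q - 3 * cnj (a_at a q))" and ?g = "\<lambda>q. cnj (g2 (u_of q))"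
  let ?ds = "\<lambda>X. da p X + cnj (da p X)"
  let ?u = "\<lambda>X. of_real (u_of X) :: complex"
  let ?D = "\<lambda>X. (?e1 p * (?u X * k3 (u_of p) + (k1 (u_of p) * (?u X * k2 (u_of p)) + (?u X * k2 (u_of p)) * k1 (u_of p)))
           + ?e1 p * (- 3 * ?ds X + ?u X * k1 (u_of p)) * ?h p)
        - ?e2 p * (- ?ds X + cnj (?u X * k1 (u_of p)))
        + (?e3 p * cnj (?u X * g2' (u_of p)) + ?e3 p * (- da p X - 3 * cnj (da p X)) * ?g p)"
  have "((\<lambda>q. ?e1 q * ?h q - ?e2 q + ?e3 q * ?g q) has_derivative ?D) (at p)"
    by (intro has_derivative_mult has_derivative_mult_right has_derivative_exp_comp has_derivative_minus
        has_derivative_diff has_derivative_add basic_derivs)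
  then have "(nu M f a has_derivative ?D) (at p)"
    by (rule has_derivative_transform_within_open[OF _ open_chart p]) (simp add: nu_eq)
  note differential_eqI[OF this]
  then have "differential (nu M f a) p X =
     (- 3 * ?e1 p * ?h p + ?e2 p - ?e3 p * ?g p) * ?ds X
     + (?e1 p * (k3 (u_of p) + 2 * k1 (u_of p) * k2 (u_of p) + k1 (u_of p) * ?h p)
        - ?e2 p * cnj (k1 (u_of p)) + ?e3 p * cnj (g2' (u_of p))) * ?u X
     - 2 * ?e3 p * ?g p * cnj (da p X)" for X
    by (simp add: algebra_simps)
  with that show thesis by blast
qed

lemma alpha_nz: "alpha a p \<noteq> 0"
  by (simp add: alpha_eq[OF p])

lemma A_inv_eq_1: "A_inv M a p = 1"
proof -
  \<comment> \<open>The second factor is also the logarithmic derivative of \<open>alpha\<close> in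
    the conjugate of zeta, so \<open>deltastar_op\<close> multiplies \<open>alpha\<close> by
    \<open>alpha\<close> itself.\<close>
  have ak: "alpha a p = exp (a_at a p - cnj (a_at a p)) * (- 1 / (2 * cnj (zeta_of p)))"
    using in_U by (simp add: alpha_def deriv_a)
  have "d_v (alpha a) p = 0"
    by (simp add: d_v_def differential_alpha da_def u_of_def zeta_of_def)
  moreover have "d_zetabar (alpha a) p = alpha a p * (- 1 / (2 * cnj (zeta_of p)))"
    by (simp add: d_zetabar_def differential_alpha da_def u_of_def zeta_of_def field_simps)
  ultimately have "deltastar_op M a (alpha a) p = alpha a p * alpha a p"
    by (simp add: deltastar_op_def) (simp add: ak)
  then show ?thesis
    using alpha_nz by (simp add: A_inv_def power2_eq_square)
qed

text \<open>Up to the factor \<open>exp (- a - cnj a)\<close>, this operator is the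
  \<open>u\<close>-derivative at fixed \<open>a\<close>, which turns \<open>k1\<close> in
  \<open>mu\<close> into \<open>k2\<close>. In the coordinates used here, the terms quadratic in
  \<open>k1\<close> and its conjugate from \<open>d_u\<close> cancel against the transport terms
  with \<open>Zu_at\<close>.\<close>

lemma Delta_mu:
  "Delta_op M f a (mu a L) p = exp (- 2 * (a_at a p + cnj (a_at a p))) * k2 (u_of p)"
proof -
  let ?e = "exp (- a_at a p - cnj (a_at a p))" and ?k1 = "k1 (u_of p)" and ?z = "zeta_of p"
  have z: "?z \<noteq> 0" using zeta_nz[OF p] .
  have v: "d_v (mu a L) p = 0"
    by (simp add: d_v_def differential_mu da_def u_of_def zeta_of_def)
  have u: "d_u (mu a L) p = ?e * (k2 (u_of p) - ?k1 * (?k1 + cnj ?k1) / 2)"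
    by (simp add: d_u_def differential_mu da_def u_of_def zeta_of_def field_simps)
  have zz: "d_zeta (mu a L) p = ?e * ?k1 / (2 * ?z)"
    by (simp add: d_zeta_def differential_mu da_def u_of_def zeta_of_def field_simps)
  have zb: "d_zetabar (mu a L) p = ?e * ?k1 / (2 * cnj ?z)"
    by (simp add: d_zetabar_def differential_mu da_def u_of_def zeta_of_def field_simps)
  have "Delta_op M f a (mu a L) p = ?e * (?e * k2 (u_of p))"
    unfolding Delta_op_def v u zz zb Zu_at_eq[OF p] using z by (simp add: field_simps)
  also have "\<dots> = (?e * ?e) * k2 (u_of p)"
    by simp
  also have "?e * ?e = exp (- 2 * (a_at a p + cnj (a_at a p)))"
    unfolding exp_add[symmetric] by (simp add: algebra_simps)
  finally show ?thesis .
qed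

text \<open>Since \<open>A_inv\<close> is 1, \<open>nu\<close> enters with factor 2. Its first term
  cancels against the quotient by \<open>alphastar\<close>, its second against
  \<open>1 / alpha\<close>, and twice the \<open>g2\<close> term remains.\<close>

lemma Y_inv_eq:
  "Y_inv M f a L p = 2 * exp (- a_at a p - 3 * cnj (a_at a p)) * cnj (g2 (u_of p))"
proof -
  let ?s = "a_at a p + cnj (a_at a p)" and ?k = "k (u_of p)"
    and ?h = "k2 (u_of p) + k1 (u_of p) * k1 (u_of p)"
  have e: "exp (x - y) = 1 / exp (y - x)" for x y :: complex
    by (simp add: exp_diff)
  have al: "1 / alpha a p = - 2 * exp (- ?s + cnj ?k)"
    unfolding alpha_eq[OF p] using e[of "cnj ?k" "?s"] by (simp add: algebra_simps)
  have "alphastar a p = - (1 / 2) * exp (?s - ?k)"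
    unfolding alphastar_def alpha_eq[OF p] by (simp add: exp_cnj add.commute)
  then have als: "1 / alphastar a p = - 2 * exp (- ?s + ?k)"
    using e[of "?k" "?s"] by (simp add: algebra_simps)
  have "(mu a L p)\<^sup>2 = (exp (- a_at a p - cnj (a_at a p)) * exp (- a_at a p - cnj (a_at a p)))
      * (k1 (u_of p) * k1 (u_of p))"
    unfolding mu_eq[OF p] by (simp add: power2_eq_square)
  also have "exp (- a_at a p - cnj (a_at a p)) * exp (- a_at a p - cnj (a_at a p)) = exp (- 2 * ?s)"
    unfolding exp_add[symmetric] by (simp add: algebra_simps)
  finally have "(Delta_op M f a (mu a L) p + (mu a L p)\<^sup>2) / alphastar a p
      = exp (- 2 * ?s) * ?h * (1 / alphastar a p)"
    unfolding Delta_mu by (simp add: distrib_left)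
  also have "\<dots> = - 2 * (exp (- 2 * ?s) * exp (- ?s + ?k)) * ?h"
    unfolding als by simp
  also have "exp (- 2 * ?s) * exp (- ?s + ?k) = exp (- 3 * ?s + ?k)"
    unfolding exp_add[symmetric] by (simp add: algebra_simps)
  finally have "Y_inv M f a L p = (3 - 1) * nu M f a p - (- 2 * exp (- ?s + cnj ?k))
      + - 2 * exp (- 3 * ?s + ?k) * ?h"
    unfolding Y_inv_def A_inv_eq_1 al by (simp only:)
  then show ?thesis
    unfolding nu_eq[OF p] by (simp only: ring_distribs) simp
qed

text \<open>Up to nonzero factors, the two differentials are \<open>da + cnj da\<close> minus the
  conjugate of \<open>k1\<close>, respectively \<open>k1\<close>, times du. For real
  \<open>k1\<close> they are proportional.\<close>

lemma type_0_2_imp_k1_not_real: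
  assumes "wedge2 (differential (alpha a) p) (differential (alphastar a) p) X W \<noteq> 0"
  shows "cnj (k1 (u_of p)) \<noteq> k1 (u_of p)"
proof
  assume "cnj (k1 (u_of p)) = k1 (u_of p)"
  then show False
    using assms by (simp add: wedge2_def differential_alphastar differential_alpha algebra_simps)
qed

lemma wedge3_eq:
  "wedge3 (differential (alpha a) p) (differential (alphastar a) p) (differential (nu M f a) p) X V W =
    - 2 * alpha a p * cnj (alpha a p) * (cnj (k1 (u_of p)) - k1 (u_of p)) *
      exp (- a_at a p - 3 * cnj (a_at a p)) * cnj (g2 (u_of p)) *
      wedge3 (da p) (\<lambda>X. of_real (u_of X)) (\<lambda>X. cnj (da p X)) X V W"
proof -
  obtain P Q where nu: "\<And>X. differential (nu M f a) p X =
     P * (da p X + cnj (da p X)) + Q * of_real (u_of X)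
     - 2 * exp (- a_at a p - 3 * cnj (a_at a p)) * cnj (g2 (u_of p)) * cnj (da p X)"
    using differential_nu by blast
  show ?thesis
    unfolding ext[OF nu] differential_alphastar differential_alpha wedge3_linear_combination
    by (simp add: mult_ac)
qed

text \<open>The test vectors are the coordinate directions Re zeta, \<open>u\<close> and Im zeta:
  only the second is seen by du, and \<open>da\<close> and its conjugate are independent on the
  other two.\<close>

lemma wedge3_da_nonzero:
  "wedge3 (da p) (\<lambda>X. of_real (u_of X)) (\<lambda>X. cnj (da p X)) (1, 0, 0) (0, 1, 0) (\<i>, 0, 0) \<noteq> 0"
  using zeta_nz[OF p]
  by (simp add: wedge3_def wedge2_def da_def u_of_def zeta_of_def field_simps)

lemma pointwise_equivalence:
  assumes "wedge2 (differential (alpha a) p) (differential (alphastar a) p) X0 W0 \<noteq> 0"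
  shows "(\<forall>X V W. wedge3 (differential (alpha a) p) (differential (alphastar a) p)
            (differential (nu M f a) p) X V W = 0) \<longleftrightarrow> g2 (u_of p) = 0"
    and "Y_inv M f a L p = 0 \<longleftrightarrow> g2 (u_of p) = 0"
proof -
  have "cnj (k1 (u_of p)) - k1 (u_of p) \<noteq> 0"
    using type_0_2_imp_k1_not_real[OF assms] by simp
  then show "(\<forall>X V W. wedge3 (differential (alpha a) p) (differential (alphastar a) p)
            (differential (nu M f a) p) X V W = 0) \<longleftrightarrow> g2 (u_of p) = 0"
    using wedge3_da_nonzero alpha_nz unfolding wedge3_eq by auto
  show "Y_inv M f a L p = 0 \<longleftrightarrow> g2 (u_of p) = 0"
    by (simp add: Y_inv_eq)
qed

end

end

section \<open>Existence of logarithmic charts\<close>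

lemma Zfun_eq:
  assumes "inj_on (\<lambda>(z, u). (a z u, u)) (base M)" "(z, t) \<in> base M" "a z t = w"
  shows "Zfun M a w t = z"
  unfolding Zfun_def
proof (rule the_equality)
  fix z' assume "(z', t) \<in> base M \<and> a z' t = w"
  with assms show "z' = z"
    using inj_onD[OF assms(1), of "(z', t)" "(z, t)"] by simp
qed (use assms in simp)

lemma log_potential_derivatives:
  assumes B: "open B" "(z, t) \<in> B" and S: "open S" "log_branch S lg" "fst ` B \<subseteq> S"
    and f: "\<And>z u. (z, u) \<in> B \<Longrightarrow> f z u = g1 u * lg z + g2 u * z"
  shows "f_zeta f z t = g2 t + g1 t / z" "f_zeta_zeta f z t = - g1 t / z\<^sup>2"
proof -
  have slice: "open ((\<lambda>w. (w, t)) -` B)"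
    by (rule open_vimage[OF B(1)]) (intro continuous_intros)
  \<comment> \<open>Established on the whole slice, since the second derivative differentiates this
    formula along it.\<close>
  have fz: "f_zeta f w t = g2 t + g1 t / w" if w: "(w, t) \<in> B" for w
    unfolding f_zeta_def
  proof (rule DERIV_imp_deriv, rule has_field_derivative_transform_within_open[OF _ slice])
    have "w \<in> S" using w S by force
    then show "((\<lambda>w. g1 t * lg w + g2 t * w) has_field_derivative g2 t + g1 t / w) (at w)"
      using log_branch_has_field_derivative[OF S(1,2), of w]
      by (auto intro!: derivative_eq_intros)
  qed (use w f in auto)
  then show "f_zeta f z t = g2 t + g1 t / z" using B by blast
  have "z \<in> S" using B S by force
  then have "z \<noteq> 0"
    using S by (metis exp_not_eq_zero log_branch_def)
  show "f_zeta_zeta f z t = - g1 t / z\<^sup>2"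
    unfolding f_zeta_zeta_def
  proof (rule DERIV_imp_deriv, rule has_field_derivative_transform_within_open[OF _ slice])
    show "((\<lambda>w. g2 t + g1 t / w) has_field_derivative - g1 t / z\<^sup>2) (at z)"
      using \<open>z \<noteq> 0\<close> by (auto intro!: derivative_eq_intros simp: power2_eq_square)
  qed (use B fz in auto)
qed

lemma continuous_on_compose_snd:
  assumes "\<And>t. t \<in> N \<Longrightarrow> (k has_vector_derivative k' t) (at t)" "snd ` U \<subseteq> N"
  shows "continuous_on U (\<lambda>x. k (snd x))"
proof -
  have "continuous_on N k"
    using assms(1) has_vector_derivative_continuous by (blast intro: continuous_at_imp_continuous_on)
  then show ?thesis
    using assms(2) by (intro continuous_on_compose2[OF _ continuous_on_snd[OF continuous_on_id]]) auto
qed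

text \<open>Only exponentials of \<open>a\<close> and \<open>L\<close> are prescribed, so their
  formulas are known up to multiples of 2 pi i. Branches are matched at the base point three times,
  for \<open>a\<close>, for \<open>lg\<close> along the inverse of \<open>a\<close>, and for
  \<open>L\<close>, and the neighbourhood shrinks each time.\<close>

lemma exists_log_chart:
  assumes wave: "vacuum_pp_wave M f" and norm: "normalizing_coordinate M f a"
    and LM: "log_Z_a_branch M a L" and lg: "log_branch (zeta_of ` M) lg"
    and f: "\<And>\<zeta> u. (\<zeta>, u) \<in> base M \<Longrightarrow> f \<zeta> u = g1 u * lg \<zeta> + g2 u * \<zeta>"
    and g1: "\<And>u. u \<in> u_of ` M \<Longrightarrow> g1 u \<noteq> 0"
    and p: "(z0, u0) \<in> base M"
  obtains g2' k k1 k2 k3 U where "log_chart M f a L lg g2 g2' k k1 k2 k3 U" "(z0, u0) \<in> U"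
proof -
  let ?B = "base M" and ?S = "zeta_of ` M"
  have openM: "open M" and smooth: "analytic_smooth ?B f"
    using wave by (auto simp: vacuum_pp_wave_def)
  have B: "open ?B" using open_base[OF openM] .
  have S: "open ?S"
    by (rule open_surjective_linear_image[OF openM bounded_linear.linear[OF bounded_linear_zeta_of]],
        rule surjI[where f = "\<lambda>z. (z, 0, 0)"]) (simp add: zeta_of_def)
  have BS: "fst ` ?B \<subseteq> ?S" by (simp add: fst_image_base)
  have Bz: "z \<in> ?S" "z \<noteq> 0" "exp (lg z) = z" "t \<in> u_of ` M" if "(z, t) \<in> ?B" for z t
  proof -
    show z: "z \<in> ?S" using that BS by force
    then show "exp (lg z) = z" using lg unfolding log_branch_def by blast
    then show "z \<noteq> 0" by (metis exp_not_eq_zero)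
    show "t \<in> u_of ` M" using that snd_image_base[of M] by force
  qed
  note lg_deriv = log_branch_has_field_derivative[OF S lg]
  note fd = log_potential_derivatives[OF B _ S lg BS f]
  have cont_a: "continuous_on ?B (\<lambda>x. a (fst x) (snd x))"
    using norm by (simp add: normalizing_coordinate_def case_prod_beta')
  have exp_a: "exp (4 * a z t) = - g1 t / z\<^sup>2" if "(z, t) \<in> ?B" for z t
    using that norm fd(2)[OF that] by (auto simp: normalizing_coordinate_def)
  have inj: "inj_on (\<lambda>(z, u). (a z u, u)) ?B"
    using norm by (simp add: normalizing_coordinate_def)
  obtain G H N where N: "open N" "u0 \<in> N"
    and GH0: "\<And>t. t \<in> N \<Longrightarrow> G 0 t = g1 t" "\<And>t. t \<in> N \<Longrightarrow> H 0 t = g2 t"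
    and GH: "\<And>n t. t \<in> N \<Longrightarrow> (G n has_vector_derivative G (Suc n) t) (at t)"
      "\<And>n t. t \<in> N \<Longrightarrow> (H n has_vector_derivative H (Suc n) t) (at t)"
    using coefficients_smooth[OF B p smooth S lg BS f] by metis
  \<comment> \<open>Restricting to values of \<open>u\<close> attained on \<open>M\<close> makes
    \<open>g1\<close> nonzero throughout.\<close>
  define N1 where "N1 = N \<inter> snd ` ?B"
  have N1: "open N1" "u0 \<in> N1"
    using N p open_image_snd[OF B] by (force simp: N1_def)+
  have nz: "G 0 t \<noteq> 0" if "t \<in> N1" for t
    using that GH0 g1 by (simp add: N1_def snd_image_base)
  define w0 where "w0 = a z0 u0"
  \<comment> \<open>The value \<open>2 * w0 + lg z0\<close> for \<open>k u0\<close> is forced by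
    \<open>a = (k - lg) / 2\<close> at the base point; this is the sign of the square root of
    \<open>- g1\<close> that fits the given \<open>a\<close>.\<close>
  have "exp (2 * (2 * w0 + lg z0)) = exp (4 * w0) * (exp (lg z0))\<^sup>2"
    by (simp add: exp_add[symmetric] exp_double[symmetric] algebra_simps)
  also have "\<dots> = - G 0 u0"
    using exp_a[OF p] Bz[OF p] GH0 N by (simp add: w0_def)
  finally have c: "exp (2 * (2 * w0 + lg z0)) = - G 0 u0" .
  obtain k k1 k2 k3 N' where N': "open N'" "u0 \<in> N'" "N' \<subseteq> N1" and k0: "k u0 = 2 * w0 + lg z0"
    and exp_k: "\<And>t. t \<in> N' \<Longrightarrow> exp (2 * k t) = - G 0 t"
    and k: "\<And>t. t \<in> N' \<Longrightarrow> (k has_vector_derivative k1 t) (at t)"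
      "\<And>t. t \<in> N' \<Longrightarrow> (k1 has_vector_derivative k2 t) (at t)"
      "\<And>t. t \<in> N' \<Longrightarrow> (k2 has_vector_derivative k3 t) (at t)"
    using smooth_half_log[OF N1 GH(1) nz c] by (metis N1_def Int_iff)
  have g1_k: "g1 t = - exp (2 * k t)" if "t \<in> N'" for t
    using that exp_k GH0 N' by (force simp: N1_def)

  define U0 where "U0 = ?B \<inter> UNIV \<times> N'"
  have U0: "open U0" "(z0, u0) \<in> U0" "U0 \<subseteq> ?B"
    using B N' p by (auto simp: U0_def open_Times)
  have cont_k: "continuous_on U0 (\<lambda>x. k (snd x))"
    by (rule continuous_on_compose_snd[OF k(1)]) (auto simp: U0_def)
  have cont_lg: "continuous_on ?S lg"
    using lg_deriv by (blast intro: DERIV_isCont continuous_at_imp_continuous_on)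
  have cont_lg0: "continuous_on U0 (\<lambda>x. lg (fst x))"
    using BS U0 by (intro continuous_on_compose2[OF cont_lg continuous_on_fst[OF continuous_on_id]]) auto
  \<comment> \<open>Both sides are continuous logarithms of the second zeta-derivative of
    \<open>f\<close> and agree at the base point by the choice of \<open>k u0\<close>.\<close>
  obtain U1 where U1: "open U1" "(z0, u0) \<in> U1" "U1 \<subseteq> U0"
    and U1_eq: "\<And>x. x \<in> U1 \<Longrightarrow> 4 * a (fst x) (snd x) = 2 * k (snd x) - 2 * lg (fst x)"
  proof (rule eq_nearby_of_exp_eq[OF U0(1,2)])
    show "continuous_on U0 (\<lambda>x. 4 * a (fst x) (snd x))"
      by (intro continuous_on_mult_left continuous_on_subset[OF cont_a U0(3)])
    show "continuous_on U0 (\<lambda>x. 2 * k (snd x) - 2 * lg (fst x))"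
      by (intro continuous_on_mult_left continuous_on_diff cont_k cont_lg0)
    show "4 * a (fst (z0, u0)) (snd (z0, u0)) = 2 * k (snd (z0, u0)) - 2 * lg (fst (z0, u0))"
      by (simp add: k0 w0_def)
    fix x assume x: "x \<in> U0"
    then obtain z t where zt: "x = (z, t)" "(z, t) \<in> ?B" "t \<in> N'"
      by (auto simp: U0_def)
    then show "exp (4 * a (fst x) (snd x)) = exp (2 * k (snd x) - 2 * lg (fst x))"
      using Bz[OF zt(2)] by (simp add: exp_a exp_diff g1_k exp_double)
  qed blast
  have a_eq: "a z t = (k t - lg z) / 2" if "(z, t) \<in> U1" for z t
  proof -
    have "2 * (lg z + 2 * a z t) = 2 * k t"
      using U1_eq[OF that] by (simp add: algebra_simps)
    then have "lg z + 2 * a z t = k t"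
      by (simp only: mult_cancel_left) simp
    then show ?thesis
      by (simp add: field_simps)
  qed

  \<comment> \<open>The candidate for \<open>Z\<close>, from solving
    \<open>a = (k - lg z) / 2\<close> for \<open>z\<close>.\<close>
  define \<zeta> where "\<zeta> x = exp (k (snd x) - 2 * fst x)" for x
  define W0 where "W0 = (UNIV :: complex set) \<times> N'"
  have W0: "open W0" "(w0, u0) \<in> W0" using N' by (auto simp: W0_def open_Times)
  have cont_kW: "continuous_on W0 (\<lambda>x. k (snd x))"
    by (rule continuous_on_compose_snd[OF k(1)]) (auto simp: W0_def)
  have cont_kw: "continuous_on W0 (\<lambda>x. k (snd x) - 2 * fst x)"
    by (intro continuous_on_diff cont_kW continuous_on_mult_left continuous_on_fst continuous_on_id)
  have cont_\<zeta>: "continuous_on W0 \<zeta>"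
    unfolding \<zeta>_def[abs_def] by (intro continuous_on_exp cont_kw)
  have \<zeta>0: "\<zeta> (w0, u0) = z0"
    using Bz[OF p] by (simp add: \<zeta>_def k0)
  define W1 where "W1 = W0 \<inter> (\<lambda>x. (\<zeta> x, snd x)) -` U1"
  have W1: "open W1" "(w0, u0) \<in> W1" "W1 \<subseteq> W0"
    using U1 W0 \<zeta>0
    by (auto simp: W1_def intro!: continuous_open_preimage continuous_on_Pair cont_\<zeta>
        continuous_on_snd continuous_on_id)
  have W1_S: "\<zeta> x \<in> ?S" "exp (lg (\<zeta> x)) = \<zeta> x" if "x \<in> W1" for x
  proof -
    have "(\<zeta> x, snd x) \<in> ?B"
      using that U1 U0 by (auto simp: W1_def)
    then show "\<zeta> x \<in> ?S" "exp (lg (\<zeta> x)) = \<zeta> x" using Bz by blast+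
  qed
  \<comment> \<open>The branch \<open>lg\<close> need not return the exponent that defines
    \<open>\<zeta>\<close>; near the base point it does, and then \<open>a\<close> maps
    \<open>\<zeta> (w, t)\<close> back to \<open>w\<close>.\<close>
  obtain W where W: "open W" "(w0, u0) \<in> W" "W \<subseteq> W1"
    and lg_\<zeta>: "\<And>x. x \<in> W \<Longrightarrow> lg (\<zeta> x) = k (snd x) - 2 * fst x"
  proof (rule eq_nearby_of_exp_eq[OF W1(1,2)])
    show "continuous_on W1 (\<lambda>x. lg (\<zeta> x))"
      using W1_S by (intro continuous_on_compose2[OF cont_lg continuous_on_subset[OF cont_\<zeta> W1(3)]]) auto
    show "continuous_on W1 (\<lambda>x. k (snd x) - 2 * fst x)"
      by (rule continuous_on_subset[OF cont_kw W1(3)])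
    show "lg (\<zeta> (w0, u0)) = k (snd (w0, u0)) - 2 * fst (w0, u0)"
      unfolding \<zeta>0 by (simp add: k0)
  qed (use W1_S in \<open>auto simp: \<zeta>_def\<close>)
  have \<zeta>_mem: "(\<zeta> (w, t), t) \<in> U1" "t \<in> N'" if "(w, t) \<in> W" for w t
    using that W W1 by (auto simp: W1_def W0_def)
  have a_\<zeta>: "a (\<zeta> (w, t)) t = w" if "(w, t) \<in> W" for w t
    using a_eq[OF \<zeta>_mem(1)[OF that]] lg_\<zeta>[OF that] by simp
  \<comment> \<open>Global injectivity on \<open>base M\<close> makes this local preimage the one
    that \<open>Zfun\<close> selects.\<close>
  have Z: "Zfun M a w t = \<zeta> (w, t)" if "(w, t) \<in> W" for w t
    using \<zeta>_mem[OF that] U1 U0 a_\<zeta>[OF that] by (intro Zfun_eq[OF inj]) auto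
  have slice_w: "open ((\<lambda>w. (w, t)) -` W)" for t
    by (rule open_vimage[OF W(1)]) (intro continuous_intros)
  have slice_t: "open ((\<lambda>t. (w, t)) -` W)" for w
    by (rule open_vimage[OF W(1)]) (intro continuous_intros)
  have Z_a: "Z_a M a w t = - 2 * exp (k t - 2 * w)" if wt: "(w, t) \<in> W" for w t
    unfolding Z_a_def
  proof (rule DERIV_imp_deriv, rule has_field_derivative_transform_within_open[OF _ slice_w])
    show "((\<lambda>w. exp (k t - 2 * w)) has_field_derivative - 2 * exp (k t - 2 * w)) (at w)"
      by (auto intro!: derivative_eq_intros)
  qed (use wt Z in \<open>auto simp: \<zeta>_def\<close>)
  have exp_kt: "((\<lambda>t. exp (k t - 2 * w)) has_vector_derivative k1 t * exp (k t - 2 * w)) (at t)"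
    if "t \<in> N'" for w t
  proof -
    have "((\<lambda>t. k t - 2 * w) has_vector_derivative k1 t - 0) (at t)"
      by (intro has_vector_derivative_diff k(1) that has_vector_derivative_const)
    from field_vector_diff_chain_at[OF this DERIV_exp] show ?thesis
      by (simp add: o_def)
  qed
  have Z_u: "Z_u M a w t = k1 t * exp (k t - 2 * w)" if wt: "(w, t) \<in> W" for w t
    unfolding Z_u_def
  proof (rule vector_derivative_at, rule has_vector_derivative_transform_within_open[OF _ slice_t])
    show "((\<lambda>t. exp (k t - 2 * w)) has_vector_derivative k1 t * exp (k t - 2 * w)) (at t)"
      using exp_kt \<zeta>_mem(2)[OF wt] by blast
  qed (use wt Z in \<open>auto simp: \<zeta>_def\<close>)
  have Z_uu: "Z_uu M a w t = (k2 t + (k1 t)\<^sup>2) * exp (k t - 2 * w)" if wt: "(w, t) \<in> W" for w t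
    unfolding Z_uu_def
  proof (rule vector_derivative_at, rule has_vector_derivative_transform_within_open[OF _ slice_t])
    have "((\<lambda>t. k1 t * exp (k t - 2 * w)) has_vector_derivative
        k1 t * (k1 t * exp (k t - 2 * w)) + k2 t * exp (k t - 2 * w)) (at t)"
      by (intro has_vector_derivative_mult exp_kt k(2) \<zeta>_mem(2)[OF wt])
    then show "((\<lambda>t. k1 t * exp (k t - 2 * w)) has_vector_derivative
        (k2 t + (k1 t)\<^sup>2) * exp (k t - 2 * w)) (at t)"
      by (simp add: algebra_simps power2_eq_square)
  qed (use wt Z_u in auto)

  have W_image: "W \<subseteq> (\<lambda>(z, u). (a z u, u)) ` ?B"
  proof safe
    fix w t assume wt: "(w, t) \<in> W"
    then have "(\<zeta> (w, t), t) \<in> ?B" using \<zeta>_mem U1 U0 by blast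
    then show "(w, t) \<in> (\<lambda>(z, u). (a z u, u)) ` ?B"
      using a_\<zeta>[OF wt] by (force simp: image_iff)
  qed
  \<comment> \<open>As \<open>Z_a\<close> is \<open>- 2 * exp (k - 2 * w)\<close>, this is the
    logarithm of -2 belonging to the given branch \<open>L\<close>. Being constant, it disappears
    from \<open>L_u\<close>.\<close>
  define c0 where "c0 = L w0 u0 - (k u0 - 2 * w0)"
  have exp_L: "exp (L w t) = - 2 * exp (k t - 2 * w)" if "(w, t) \<in> W" for w t
  proof -
    have "exp (L w t) = Z_a M a w t"
      using that W_image LM unfolding log_Z_a_branch_def by blast
    then show ?thesis by (simp only: Z_a[OF that])
  qed
  have exp_c0: "exp c0 = - 2"
    using exp_L[OF W(2)] by (simp add: c0_def exp_diff)
  obtain W' where W': "open W'" "(w0, u0) \<in> W'" "W' \<subseteq> W"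
    and L: "\<And>x. x \<in> W' \<Longrightarrow> L (fst x) (snd x) = c0 + (k (snd x) - 2 * fst x)"
  proof (rule eq_nearby_of_exp_eq[OF W(1,2)])
    show "continuous_on W (\<lambda>x. L (fst x) (snd x))"
      using LM W_image by (auto simp: log_Z_a_branch_def case_prod_beta' intro: continuous_on_subset)
    show "continuous_on W (\<lambda>x. c0 + (k (snd x) - 2 * fst x))"
      using W W1 by (intro continuous_on_add continuous_on_const continuous_on_subset[OF cont_kw]) auto
    show "L (fst (w0, u0)) (snd (w0, u0)) = c0 + (k (snd (w0, u0)) - 2 * fst (w0, u0))"
      by (simp add: c0_def)
    fix x assume "x \<in> W"
    then show "exp (L (fst x) (snd x)) = exp (c0 + (k (snd x) - 2 * fst x))"
      using exp_L[of "fst x" "snd x"] by (simp add: exp_add exp_c0)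
  qed blast
  have L_u: "L_u L w t = k1 t" if wt: "(w, t) \<in> W'" for w t
    unfolding L_u_def
  proof (rule vector_derivative_at, rule has_vector_derivative_transform_within_open)
    show "open ((\<lambda>t. (w, t)) -` W')"
      by (rule open_vimage[OF W'(1)]) (intro continuous_intros)
    have "((\<lambda>t. c0 + (k t - 2 * w)) has_vector_derivative 0 + (k1 t - 0)) (at t)"
      using wt W' \<zeta>_mem
      by (intro has_vector_derivative_add has_vector_derivative_diff has_vector_derivative_const k(1)) blast
    then show "((\<lambda>t. c0 + (k t - 2 * w)) has_vector_derivative k1 t) (at t)"
      by simp
  qed (use wt L in force)+

  \<comment> \<open>On \<open>U1\<close> the formula for \<open>a\<close> holds, and the pullback of
    \<open>W'\<close> adds those for \<open>Z\<close> and \<open>L\<close> at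
    \<open>(a z t, t)\<close>.\<close>
  define U where "U = U1 \<inter> (\<lambda>x. (a (fst x) (snd x), snd x)) -` W'"
  have "open U"
    unfolding U_def
    using U1 U0 W' by (intro continuous_open_preimage continuous_on_Pair continuous_on_subset[OF cont_a]
        continuous_on_snd continuous_on_id) auto
  have U_mem: "(z, t) \<in> U1" "(z, t) \<in> ?B" "t \<in> N'" "t \<in> N" "(a z t, t) \<in> W'" "(a z t, t) \<in> W"
    "exp (k t - 2 * a z t) = z" if zt: "(z, t) \<in> U" for z t
  proof -
    show *: "(z, t) \<in> U1" "(a z t, t) \<in> W'" using zt by (auto simp: U_def)
    then show B': "(z, t) \<in> ?B" and "t \<in> N'" and "(a z t, t) \<in> W"
      using U1 U0 W' by (auto simp: U0_def)
    then show "t \<in> N" using N' by (auto simp: N1_def)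
    show "exp (k t - 2 * a z t) = z"
      using Bz(3)[OF B'] by (simp add: a_eq[OF *(1)] diff_divide_distrib right_diff_distrib)
  qed
  have "log_chart M f a L lg g2 (\<lambda>t. H 1 t) k k1 k2 k3 U"
  proof
    fix z t assume zt: "(z, t) \<in> U"
    note m = U_mem[OF zt]
    show "exp (lg z) = z" "(lg has_field_derivative 1 / z) (at z)"
      using Bz[OF m(2)] lg_deriv by auto
    show "(k has_vector_derivative k1 t) (at t)" "(k1 has_vector_derivative k2 t) (at t)"
      "(k2 has_vector_derivative k3 t) (at t)"
      using k m by auto
    \<comment> \<open>\<open>g2\<close> coincides with \<open>H 0\<close> on the open set
      \<open>N\<close>, so it inherits the derivative.\<close>
    show "(g2 has_vector_derivative H 1 t) (at t)"
      using has_vector_derivative_transform_within_open[OF _ N(1) m(4) GH0(2)] GH(2)[OF m(4), of 0]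
      by simp
    show "a z t = (k t - lg z) / 2" using a_eq m by blast
    show "f_zeta f z t = g2 t - exp (2 * k t) / z"
      using fd(1)[OF m(2)] g1_k m by simp
    show "Z_u M a (a z t) t = k1 t * z" "Z_uu M a (a z t) t = (k2 t + (k1 t)\<^sup>2) * z"
      using Z_u Z_uu m by auto
    show "L_u L (a z t) t = k1 t" using L_u m by blast
  qed (rule \<open>open U\<close>)
  moreover have "(z0, u0) \<in> U"
    using U1 W' by (simp add: U_def w0_def)
  ultimately show thesis by (rule that)
qed

section \<open>From pointwise equivalences to the whole domain\<close>

theorem proposition6p7:
  fixes M :: "event set"
    and f a L :: "complex \<Rightarrow> real \<Rightarrow> complex"
    and lg :: "complex \<Rightarrow> complex"
    and g1 g2 :: "real \<Rightarrow> complex"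
  assumes "vacuum_pp_wave M f"
    and "normalizing_coordinate M f a"
    and "log_Z_a_branch M a L"
    and "log_branch (zeta_of ` M) lg"
    and "\<And>\<zeta> u. (\<zeta>, u) \<in> base M \<Longrightarrow> f \<zeta> u = g1 u * lg \<zeta> + g2 u * \<zeta>"
    and "\<And>u. u \<in> u_of ` M \<Longrightarrow> g1 u \<noteq> 0"
    and "type_0_2 M a"
  shows "((\<forall>p\<in>M. \<forall>X V W.
             wedge3 (differential (alpha a) p) (differential (alphastar a) p)
               (differential (nu M f a) p) X V W = 0)
           \<longleftrightarrow> (\<forall>p\<in>M. Y_inv M f a L p = 0))
       \<and> ((\<forall>p\<in>M. Y_inv M f a L p = 0) \<longleftrightarrow> (\<forall>u\<in>u_of ` M. g2 u = 0))"
proof -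
  have pointwise:
    "((\<forall>X V W. wedge3 (differential (alpha a) p) (differential (alphastar a) p)
            (differential (nu M f a) p) X V W = 0) \<longleftrightarrow> g2 (u_of p) = 0)
      \<and> (Y_inv M f a L p = 0 \<longleftrightarrow> g2 (u_of p) = 0)" if p: "p \<in> M" for p
  proof -
    have pB: "(zeta_of p, u_of p) \<in> base M"
      using p by (auto simp: base_def)
    \<comment> \<open>Each point gets its own chart and its own \<open>k\<close>; the resulting
      equivalence mentions only \<open>g2\<close> at that point, so nothing has to be glued.\<close>
    obtain g2' k k1 k2 k3 U where "log_chart M f a L lg g2 g2' k k1 k2 k3 U"
      and zu_in_U: "(zeta_of p, u_of p) \<in> U"
      by (rule exists_log_chart[OF assms(1-6) pB])
    then interpret log_chart M f a L lg g2 g2' k k1 k2 k3 U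
      by simp
    have chart: "p \<in> chart"
      using zu_in_U by (simp add: chart_def)
    obtain X W where "wedge2 (differential (alpha a) p) (differential (alphastar a) p) X W \<noteq> 0"
      using assms(7) p unfolding type_0_2_def by blast
    then show ?thesis
      using pointwise_equivalence[OF chart] by (intro conjI)
  qed
  have "(\<forall>p\<in>M. \<forall>X V W. wedge3 (differential (alpha a) p) (differential (alphastar a) p)
      (differential (nu M f a) p) X V W = 0) \<longleftrightarrow> (\<forall>p\<in>M. g2 (u_of p) = 0)"
    by (rule ball_cong[OF refl]) (rule conjunct1[OF pointwise])
  moreover have "(\<forall>p\<in>M. Y_inv M f a L p = 0) \<longleftrightarrow> (\<forall>p\<in>M. g2 (u_of p) = 0)"
    by (rule ball_cong[OF refl]) (rule conjunct2[OF pointwise])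
  moreover have "(\<forall>u\<in>u_of ` M. g2 u = 0) \<longleftrightarrow> (\<forall>p\<in>M. g2 (u_of p) = 0)"
    by blast
  ultimately show ?thesis by argo
qed

end
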